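(* Let an $s$-stage SSP Runge--Kutta method with coefficients $(A,b)$, $A\in\mathbb{R}^{s\times s}$, $b\in\mathbb{R}^s$, be given, where for each $2\le j\le s$ row $j$ of $A$ is not identically zero. Let $(A,\overline{b})$ be a dense output formula of order at least two whose weight functions $\overline{b}_j:[0,1]\to\mathbb{R}$ ($1\le j\le s$) are right-differentiable at $0$. Suppose that $\mathcal{C}(A,b,\overline{b})>0$. Then the first row of $A$ is identically zero, and $$\overline{b}_1'(0)=1,\qquad \overline{b}_j'(0)=0\quad\text{for all } 2\le j\le s,$$ where $\overline{b}_j'(0)$ denotes the right-derivative at $0$.
   Context: An $s$-stage Runge--Kutta method $(A,b)$, with $A=(a_{i,j})\in\mathbb{R}^{s\times s}$ and $b\in\mathbb{R}^s$, approximates solutions of $u'=f(u)$ by $y_i=u_n+h\sum_{j=1}^s a_{i,j}f(y_j)$, $u_{n+1}=u_n+h\sum_{j=1}^s b_jf(y_j)$. Its abscissas are $c_i:=\sum_{j=1}^s a_{i,j}$. A dense output formula for it is given by a function $\overline{b}=(\overline{b}_1,\dots,\overline{b}_s):[0,1]\to\mathbb{R}^s$, via $u_{n+\theta}=u_n+h\sum_{j=1}^s\overline{b}_j(\theta)f(y_j)$. It has order at least two if for all $\theta\in[0,1]$: $\sum_{j=1}^s\overline{b}_j(\theta)=\theta$ and $\sum_{j=1}^s\overline{b}_j(\theta)c_j=\theta^2/2$. Let $e=(1,\dots,1)^\top\in\mathbb{R}^s$; all matrix/vector inequalities are componentwise. For $r\ge 0$ such that $(I+rA)^{-1}$ exists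 consider the conditions (i) $A(I+rA)^{-1}\ge 0$ and $rA(I+rA)^{-1}e\le 1$; (ii) $b^\top(I+rA)^{-1}\ge 0$ and $rb^\top(I+rA)^{-1}e\le 1$; (iii) $\overline{b}(\theta)^\top(I+rA)^{-1}\ge 0$ and $r\overline{b}(\theta)^\top(I+rA)^{-1}e\le 1$ for all $0\le\theta\le 1$. The method is SSP (strong stability preserving) if (i) and (ii) hold for some $r>0$. $\mathcal{C}(A,b)$ is the supremum of the set of $r\ge 0$ for which $(I+rA)^{-1}$ exists and (i), (ii) hold (and $0$ if this set is empty). $\mathcal{C}(A,\overline{b})$ is the supremum of the set of $r\ge 0$ for which $(I+rA)^{-1}$ exists and (i), (iii) hold (and $0$ if this set is empty). Finally $\mathcal{C}(A,b,\overline{b}):=\min(\mathcal{C}(A,b),\mathcal{C}(A,\overline{b}))$. Suprema are taken in $[0,\infty]$. *)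

theory Defs
  imports "HOL-Analysis.Analysis"
begin

text \<open>
  The stages \<open>1, \<dots>, s\<close> are the elements of a finite linearly ordered type \<open>'s\<close>; every such type is
  order isomorphic to \<open>{1, \<dots>, s}\<close> with \<open>s = CARD('s) \<ge> 1\<close>. Stage 1 is its least element.

  The order on \<open>real^'s\<close> and \<open>real^'s^'s\<close> is componentwise, and \<open>1 :: real^'s\<close> is the vector
  \<open>e = (1, \<dots>, 1)\<close>, whereas the identity matrix is \<open>mat 1\<close>.
\<close>

definition first_stage :: "'s::{finite,linorder}" where
  "first_stage = Min UNIV"

definition abscissas :: "real^'s^'s \<Rightarrow> real^'s" where
  "abscissas A = (\<chi> i. \<Sum>j\<in>UNIV. A $ i $ j)"

definition dense_order_ge_2 :: "real^'s^'s \<Rightarrow> (real \<Rightarrow> real^'s) \<Rightarrow> bool" where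
  "dense_order_ge_2 A bbar \<longleftrightarrow>
     (\<forall>\<theta>\<in>{0..1}. (\<Sum>j\<in>UNIV. bbar \<theta> $ j) = \<theta> \<and>
                (\<Sum>j\<in>UNIV. bbar \<theta> $ j * abscissas A $ j) = \<theta>\<^sup>2 / 2)"

abbreviation resolvent :: "real^'s^'s \<Rightarrow> real \<Rightarrow> real^'s^'s" where
  "resolvent A r \<equiv> matrix_inv (mat 1 + r *\<^sub>R A)"

definition stage_cond :: "real^'s^'s \<Rightarrow> real \<Rightarrow> bool" where
  "stage_cond A r \<longleftrightarrow>
     0 \<le> A ** resolvent A r \<and> r *\<^sub>R ((A ** resolvent A r) *v 1) \<le> 1"

definition weight_cond :: "real^'s^'s \<Rightarrow> real^'s \<Rightarrow> real \<Rightarrow> bool" where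
  "weight_cond A w r \<longleftrightarrow>
     0 \<le> w v* resolvent A r \<and> r * ((w v* resolvent A r) \<bullet> 1) \<le> 1"

definition ssp_radii :: "real^'s^'s \<Rightarrow> real^'s \<Rightarrow> real set" where
  "ssp_radii A b =
     {r. 0 \<le> r \<and> invertible (mat 1 + r *\<^sub>R A) \<and> stage_cond A r \<and> weight_cond A b r}"

definition dense_ssp_radii :: "real^'s^'s \<Rightarrow> (real \<Rightarrow> real^'s) \<Rightarrow> real set" where
  "dense_ssp_radii A bbar =
     {r. 0 \<le> r \<and> invertible (mat 1 + r *\<^sub>R A) \<and> stage_cond A r \<and>
         (\<forall>\<theta>\<in>{0..1}. weight_cond A (bbar \<theta>) r)}"

definition SSP :: "real^'s^'s \<Rightarrow> real^'s \<Rightarrow> bool" where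
  "SSP A b \<longleftrightarrow> (\<exists>r>0. r \<in> ssp_radii A b)"

text \<open>In \<^typ>\<open>ennreal\<close>, i.e. \<open>[0, \<infinity>]\<close>, the supremum of the empty set is 0.\<close>

definition ssp_coeff :: "real^'s^'s \<Rightarrow> real^'s \<Rightarrow> ennreal" where
  "ssp_coeff A b = (SUP r\<in>ssp_radii A b. ennreal r)"

definition dense_ssp_coeff :: "real^'s^'s \<Rightarrow> (real \<Rightarrow> real^'s) \<Rightarrow> ennreal" where
  "dense_ssp_coeff A bbar = (SUP r\<in>dense_ssp_radii A bbar. ennreal r)"

definition combined_ssp_coeff ::
    "real^'s^'s \<Rightarrow> real^'s \<Rightarrow> (real \<Rightarrow> real^'s) \<Rightarrow> ennreal" where
  "combined_ssp_coeff A b bbar = min (ssp_coeff A b) (dense_ssp_coeff A bbar)"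

end

theory Submission
  imports Defs
begin

text \<open>
  With \<open>M = I + r A\<close> and \<open>K = A M\<^sup>-\<^sup>1\<close> one has \<open>M\<^sup>-\<^sup>1 = I - r K\<close>, and the stage conditions say
  that \<open>K\<close> is nonnegative and \<open>r K\<close> has row sums at most 1. A minimum principle then gives \<open>M \<ge> 0\<close>,
  hence \<open>A = K M \<ge> 0\<close> and \<open>bbar(\<theta>)\<^sup>T = (bbar(\<theta>)\<^sup>T M\<^sup>-\<^sup>1) M \<ge> 0\<close>. So all abscissas are nonnegative, and
  the second order condition forces \<open>bbar\<^sub>j(\<theta>) = O(\<theta>\<^sup>2)\<close> at every stage whose row of \<open>A\<close> is nonzero.
  As the weights sum to \<open>\<theta>\<close>, this cannot happen at all stages, so the first row vanishes and
  the first weight carries the whole derivative.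
\<close>

lemma matrix_vector_mult_nonneg:
  fixes K :: "real^'n^'m"
  assumes "0 \<le> K" "0 \<le> x"
  shows "0 \<le> K *v x"
  using assms by (auto simp: less_eq_vec_def matrix_vector_mult_def intro!: sum_nonneg)

lemma vector_matrix_mult_nonneg:
  fixes M :: "real^'n^'m"
  assumes "0 \<le> M" "0 \<le> w"
  shows "0 \<le> w v* M"
  using assms by (auto simp: less_eq_vec_def vector_matrix_mult_def intro!: sum_nonneg)

lemma matrix_mult_nonneg:
  fixes K :: "real^'n^'m" and M :: "real^'p^'n"
  assumes "0 \<le> K" "0 \<le> M"
  shows "0 \<le> K ** M"
  using assms by (auto simp: less_eq_vec_def matrix_matrix_mult_def intro!: sum_nonneg)

text \<open>At an index \<open>i\<close> where \<open>x\<close> is minimal, a negative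
  \<open>x $ i\<close> would give \<open>(K *v x) $ i \<ge> x $ i\<close>, because row
  \<open>i\<close> of \<open>K\<close> is nonnegative with sum at most 1; this contradicts
  \<open>pos\<close>.\<close>

lemma substochastic_strict_minimum_principle:
  fixes K :: "real^'n^'n"
  assumes "0 \<le> K" "K *v 1 \<le> 1" and pos: "\<And>i. 0 < (x - K *v x) $ i"
  shows "0 \<le> x"
proof -
  obtain i where i: "\<And>j. x $ i \<le> x $ j"
    using ex_min_if_finite[of "range (\<lambda>j. x $ j)"] by (force simp: not_less)
  have "0 \<le> x $ i"
  proof (rule ccontr)
    assume neg: "\<not> 0 \<le> x $ i"
    have row: "(\<Sum>j\<in>UNIV. K $ i $ j) \<le> 1"
      using assms(2) by (simp add: less_eq_vec_def matrix_vector_mult_def)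
    have "x $ i \<le> (\<Sum>j\<in>UNIV. K $ i $ j) * x $ i"
      using mult_right_mono_neg[OF row, of "x $ i"] neg by simp
    also have "\<dots> = (\<Sum>j\<in>UNIV. K $ i $ j * x $ i)"
      by (rule sum_distrib_right)
    also have "\<dots> \<le> (\<Sum>j\<in>UNIV. K $ i $ j * x $ j)"
      using assms(1) i by (intro sum_mono mult_left_mono) (auto simp: less_eq_vec_def)
    also have "\<dots> < x $ i"
      using pos[of i] by (simp add: matrix_vector_mult_def)
    finally show False by simp
  qed
  then show ?thesis
    using i by (auto simp: less_eq_vec_def intro: order_trans)
qed

text \<open>Perturbing by \<open>\<epsilon> M e\<close>, which \<open>I - K\<close> maps to \<open>\<epsilon> e\<close>, reduces to the strict case.\<close>

lemma substochastic_inverse_nonneg: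
  fixes K M :: "real^'n^'n"
  assumes K: "0 \<le> K" "K *v 1 \<le> 1" and inv: "(mat 1 - K) ** M = mat 1"
  shows "0 \<le> M"
proof -
  have eq: "M *v z - K *v (M *v z) = z" for z
    using arg_cong[OF inv, of "\<lambda>N. N *v z"]
    by (simp add: matrix_vector_mul_assoc[symmetric] matrix_vector_mult_diff_rdistrib)
  have "0 \<le> M $ i $ j" for i j
  proof -
    have pert: "0 \<le> M $ i $ j + e * (M *v 1) $ i" if "e > 0" for e
    proof -
      \<comment> \<open>By \<open>eq\<close>, \<open>I - K\<close> sends this vector to
        \<open>axis j 1 + e *\<^sub>R 1\<close>, whose entries are all at least
        \<open>e > 0\<close>. The summand \<open>axis j 1\<close> selects column \<open>j\<close> of
        \<open>M\<close>.\<close>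
      have "0 \<le> M *v (axis j 1 + e *\<^sub>R 1)"
        using that
        by (intro substochastic_strict_minimum_principle[OF K]) (simp add: eq axis_def)
      then show ?thesis
        by (simp add: less_eq_vec_def matrix_vector_right_distrib matrix_vector_mult_scaleR
            matrix_vector_mult_basis column_def)
    qed
    have "((\<lambda>e. M $ i $ j + e * (M *v 1) $ i) \<longlongrightarrow> M $ i $ j + 0 * (M *v 1) $ i) (at_right 0)"
      by (intro tendsto_intros)
    then have "((\<lambda>e. M $ i $ j + e * (M *v 1) $ i) \<longlongrightarrow> M $ i $ j) (at_right 0)"
      by simp
    then show ?thesis
      by (rule tendsto_lowerbound)
        (auto simp: eventually_at_right_field intro!: exI[of _ 1] pert)
  qed
  then show ?thesis by (simp add: less_eq_vec_def)
qed

lemma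
  fixes M :: "'a::semiring_1^'n^'m"
  assumes "invertible M"
  shows matrix_inv_right: "M ** matrix_inv M = mat 1"
    and matrix_inv_left: "matrix_inv M ** M = mat 1"
  using someI_ex[OF assms[unfolded invertible_def]] by (simp_all add: matrix_inv_def)

lemma matrix_diff_rdistrib:
  fixes B C :: "'a::ring_1^'n^'m" and A :: "'a^'p^'n"
  shows "(B - C) ** A = B ** A - C ** A"
  by (simp add: vec_eq_iff matrix_matrix_mult_def left_diff_distrib sum_subtractf)

lemma stage_cond_nonneg:
  assumes "0 \<le> r" "invertible (mat 1 + r *\<^sub>R A)" "stage_cond A r"
  shows "0 \<le> mat 1 + r *\<^sub>R A" "0 \<le> A"
proof -
  define M K where "M = mat 1 + r *\<^sub>R A" and "K = A ** matrix_inv M"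
  have inv: "M ** matrix_inv M = mat 1" "matrix_inv M ** M = mat 1"
    using assms(2) by (simp_all add: M_def matrix_inv_right matrix_inv_left)
  have K: "0 \<le> K" "(r *\<^sub>R K) *v 1 \<le> 1"
    using assms(3) by (simp_all add: stage_cond_def K_def M_def scaleR_matrix_vector_assoc)
  have KM: "K ** M = A"
    by (simp add: K_def matrix_mul_assoc[symmetric] inv)
  have rK: "0 \<le> r *\<^sub>R K"
    using K(1) assms(1) by (simp add: less_eq_vec_def)
  \<comment> \<open>The substochastic matrix here is \<open>r *\<^sub>R K\<close>; no division by
    \<open>r\<close> occurs, so \<open>r = 0\<close> is covered.\<close>
  have "(mat 1 - r *\<^sub>R K) ** M = M - r *\<^sub>R (K ** M)"
    by (simp add: matrix_diff_rdistrib scalar_matrix_assoc)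
  also have "\<dots> = mat 1"
    unfolding KM by (simp add: M_def)
  finally have M: "0 \<le> M"
    by (rule substochastic_inverse_nonneg[OF rK K(2)])
  then show "0 \<le> mat 1 + r *\<^sub>R A" by (simp add: M_def)
  show "0 \<le> A"
    using matrix_mult_nonneg[OF K(1) M] by (simp add: KM)
qed

lemma weight_cond_nonneg:
  assumes "0 \<le> r" "invertible (mat 1 + r *\<^sub>R A)" "stage_cond A r" "weight_cond A w r"
  shows "0 \<le> w"
proof -
  have "0 \<le> (w v* resolvent A r) v* (mat 1 + r *\<^sub>R A)"
    using assms(4) stage_cond_nonneg(1)[OF assms(1-3)]
    by (intro vector_matrix_mult_nonneg[of "mat 1 + r *\<^sub>R A"]) (simp_all add: weight_cond_def)
  then show ?thesis
    using assms(2) by (simp add: vector_matrix_mul_assoc matrix_inv_left)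
qed

text \<open>The bounds at 0 force \<open>f 0 = 0\<close>, and the difference quotient is squeezed
  between 0 and \<open>C * x\<close>.\<close>

lemma has_real_derivative_zero_at_right:
  fixes f :: "real \<Rightarrow> real"
  assumes "\<And>x. x \<in> {0..1} \<Longrightarrow> 0 \<le> f x" "\<And>x. x \<in> {0..1} \<Longrightarrow> f x \<le> C * x\<^sup>2"
  shows "(f has_real_derivative 0) (at_right 0)"
proof -
  have f0: "f 0 = 0"
    using assms[of 0] by simp
  have "\<forall>\<^sub>F x in at_right 0. 0 < x \<and> x < (1::real)"
    by (auto simp: eventually_at_right_field intro!: exI[of _ 1])
  then have bound: "\<forall>\<^sub>F x in at_right 0. 0 \<le> f x / x \<and> f x / x \<le> C * x"
  proof eventually_elim
    case (elim x)
    then show ?case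
      using assms[of x] by (simp add: divide_le_eq power2_eq_square mult.assoc)
  qed
  have "((\<lambda>x. C * x) \<longlongrightarrow> C * 0) (at_right 0)"
    by (intro tendsto_intros)
  then have lim: "((\<lambda>x. C * x) \<longlongrightarrow> 0) (at_right 0)"
    by simp
  have "((\<lambda>x. f x / x) \<longlongrightarrow> 0) (at_right 0)"
    by (rule tendsto_sandwich[OF _ _ tendsto_const lim])
      (use bound in \<open>auto elim: eventually_mono\<close>)
  then show ?thesis
    by (simp add: has_field_derivative_iff f0)
qed

theorem theorem2:
  fixes A :: "real^('s::{finite,linorder})^('s::{finite,linorder})"
    and b :: "real^('s::{finite,linorder})"
    and bbar :: "real \<Rightarrow> real^('s::{finite,linorder})"
  assumes "SSP A b"
    and "\<And>j. j \<noteq> first_stage \<Longrightarrow> row j A \<noteq> 0"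
    and "dense_order_ge_2 A bbar"
    and "\<And>j. (\<lambda>\<theta>. bbar \<theta> $ j) differentiable (at_right 0)"
    and "combined_ssp_coeff A b bbar > 0"
  shows "row first_stage A = 0 \<and>
         ((\<lambda>\<theta>. bbar \<theta> $ first_stage) has_real_derivative 1) (at_right 0) \<and>
         (\<forall>j. j \<noteq> first_stage \<longrightarrow> ((\<lambda>\<theta>. bbar \<theta> $ j) has_real_derivative 0) (at_right 0))"
proof -
  let ?c = "abscissas A"
  \<comment> \<open>A positive supremum yields an admissible \<open>r\<close>, and this single
    \<open>r\<close> serves every \<open>\<theta>\<close>.\<close>
  have "dense_ssp_coeff A bbar > 0"
    using assms(5) by (simp add: combined_ssp_coeff_def)
  then obtain r where r: "0 \<le> r" "invertible (mat 1 + r *\<^sub>R A)" "stage_cond A r"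
    and w: "\<And>\<theta>. \<theta> \<in> {0..1} \<Longrightarrow> weight_cond A (bbar \<theta>) r"
    by (fastforce simp: dense_ssp_coeff_def dense_ssp_radii_def less_SUP_iff)
  have A: "0 \<le> A $ i $ j" for i j
    using stage_cond_nonneg(2)[OF r] by (simp add: less_eq_vec_def)
  have bbar: "0 \<le> bbar \<theta> $ j" if "\<theta> \<in> {0..1}" for \<theta> j
    using weight_cond_nonneg[OF r w[OF that]] by (simp add: less_eq_vec_def)
  have c: "0 \<le> ?c $ j" for j
    by (simp add: abscissas_def sum_nonneg A)
  have c_pos: "0 < ?c $ j" if "row j A \<noteq> 0" for j
  proof -
    \<comment> \<open>Nonnegative entries cannot cancel in a row sum.\<close>
    have "?c $ j \<noteq> 0"
      using that A by (auto simp: abscissas_def sum_nonneg_eq_0_iff row_def vec_eq_iff)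
    with c[of j] show ?thesis by simp
  qed
  have sum_bbar: "(\<Sum>j\<in>UNIV. bbar \<theta> $ j) = \<theta>"
    and sum_bbar_c: "(\<Sum>j\<in>UNIV. bbar \<theta> $ j * ?c $ j) = \<theta>\<^sup>2 / 2" if "\<theta> \<in> {0..1}" for \<theta>
    using assms(3) that by (auto simp: dense_order_ge_2_def)
  have deriv0: "((\<lambda>\<theta>. bbar \<theta> $ j) has_real_derivative 0) (at_right 0)" if "row j A \<noteq> 0" for j
  proof (rule has_real_derivative_zero_at_right)
    fix \<theta> :: real assume \<theta>: "\<theta> \<in> {0..1}"
    show "0 \<le> bbar \<theta> $ j" by (rule bbar[OF \<theta>])
    \<comment> \<open>One term of a nonnegative sum is at most the total
      \<open>\<theta>\<^sup>2 / 2\<close>; dividing by \<open>?c $ j > 0\<close> gives the constant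
      \<open>1 / (2 * ?c $ j)\<close>.\<close>
    have "bbar \<theta> $ j * ?c $ j \<le> (\<Sum>j\<in>UNIV. bbar \<theta> $ j * ?c $ j)"
      by (rule member_le_sum) (auto intro: mult_nonneg_nonneg bbar[OF \<theta>] c)
    then show "bbar \<theta> $ j \<le> 1 / (2 * ?c $ j) * \<theta>\<^sup>2"
      using c_pos[OF that] sum_bbar_c[OF \<theta>] by (simp add: field_simps)
  qed
  have "((\<lambda>\<theta>::real. \<theta>) has_real_derivative 1) (at_right 0)"
    by (rule DERIV_ident)
  \<comment> \<open>The order condition holds only on \<open>{0..1}\<close>, so the derivative of
    the identity is transferred through equality near 0 from the right and at 0 itself.\<close>
  moreover have "\<forall>\<^sub>F \<theta> in at_right 0. (\<Sum>j\<in>UNIV. bbar \<theta> $ j) = \<theta>"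
    using sum_bbar by (auto simp: eventually_at_right_field intro!: exI[of _ 1])
  ultimately have sum1: "((\<lambda>\<theta>. \<Sum>j\<in>UNIV. bbar \<theta> $ j) has_real_derivative 1) (at_right 0)"
    using sum_bbar[of 0] by (subst has_field_derivative_cong_eventually) auto
  have first: "row first_stage A = 0"
  proof (rule ccontr)
    assume "row first_stage A \<noteq> 0"
    then have "row j A \<noteq> 0" for j
      using assms(2) by (cases "j = first_stage") auto
    then have "((\<lambda>\<theta>. \<Sum>j\<in>UNIV. bbar \<theta> $ j) has_real_derivative (\<Sum>j\<in>(UNIV :: 's set). 0)) (at_right 0)"
      by (intro DERIV_sum deriv0)
    then have "((\<lambda>\<theta>. \<Sum>j\<in>UNIV. bbar \<theta> $ j) has_real_derivative 0) (at_right 0)"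
      by simp
    with sum1 have "(1::real) = 0"
      by (rule has_field_derivative_unique) simp
    then show False by simp
  qed
  \<comment> \<open>The zero first row leaves \<open>deriv0\<close> silent about the first weight,
    which is recovered as the total minus the other weights.\<close>
  have "((\<lambda>\<theta>. (\<Sum>j\<in>UNIV. bbar \<theta> $ j) - (\<Sum>j\<in>UNIV - {first_stage}. bbar \<theta> $ j))
          has_real_derivative 1 - (\<Sum>j\<in>UNIV - {first_stage :: 's}. 0)) (at_right 0)"
    using assms(2) by (intro DERIV_diff sum1 DERIV_sum deriv0) auto
  then have "((\<lambda>\<theta>. bbar \<theta> $ first_stage) has_real_derivative 1) (at_right 0)"
    by (simp add: sum_diff1)
  with first show ?thesis
    using assms(2) deriv0 by blast
qed

end
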